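(* If $G$ is a connected unicyclic graph, then $D(G)=\dim(G)+1$ if and only if $G$ is isomorphic to one of $C_3$, $C_4$, $C_5$.
   Context: All graphs are finite and simple; a unicyclic graph is a graph containing exactly one cycle; $C_m$ is the cycle on $m$ vertices. For a connected graph $G$ with shortest-path distance $d_G$, a set $S\subseteq V(G)$ is resolving if for any two distinct vertices $x,y$ there is $s\in S$ with $d_G(x,s)\neq d_G(y,s)$; the metric dimension $\dim(G)$ is the minimum size of a resolving set. A distinguishing coloring of a graph $G$ is a (not necessarily proper) vertex coloring such that the only automorphism of $G$ mapping every vertex to a vertex of the same color is the identity; the distinguishing number $D(G)$ is the minimum number of colors in a distinguishing coloring of $G$. *)

theory Defs
  imports Main
begin

definition simple_graph :: "'a set \<Rightarrow> 'a set set \<Rightarrow> bool" where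
  "simple_graph V E \<longleftrightarrow> finite V \<and> (\<forall>e\<in>E. \<exists>u v. e = {u, v} \<and> u \<in> V \<and> v \<in> V \<and> u \<noteq> v)"

definition adj :: "'a set set \<Rightarrow> 'a \<Rightarrow> 'a \<Rightarrow> bool" where
  "adj E u v \<longleftrightarrow> {u, v} \<in> E"

definition walk :: "'a set \<Rightarrow> 'a set set \<Rightarrow> 'a list \<Rightarrow> bool" where
  "walk V E xs \<longleftrightarrow> xs \<noteq> [] \<and> set xs \<subseteq> V \<and>
     (\<forall>i. Suc i < length xs \<longrightarrow> adj E (xs ! i) (xs ! Suc i))"

definition connected_graph :: "'a set \<Rightarrow> 'a set set \<Rightarrow> bool" where
  "connected_graph V E \<longleftrightarrow> V \<noteq> {} \<and>
     (\<forall>x\<in>V. \<forall>y\<in>V. \<exists>xs. walk V E xs \<and> hd xs = x \<and> last xs = y)"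

definition gdist :: "'a set \<Rightarrow> 'a set set \<Rightarrow> 'a \<Rightarrow> 'a \<Rightarrow> nat" where
  "gdist V E x y = (LEAST n. \<exists>xs. walk V E xs \<and> hd xs = x \<and> last xs = y \<and> length xs = Suc n)"

text \<open>A cycle: closed sequence of at least 3 distinct vertices, consecutive ones adjacent.
  The cycle (as a subgraph) is identified with its edge set.\<close>
definition is_cycle :: "'a set \<Rightarrow> 'a set set \<Rightarrow> 'a list \<Rightarrow> bool" where
  "is_cycle V E xs \<longleftrightarrow> length xs \<ge> 3 \<and> distinct xs \<and> walk V E xs \<and> adj E (last xs) (hd xs)"

definition cycle_edges :: "'a list \<Rightarrow> 'a set set" where
  "cycle_edges xs = {{xs ! i, xs ! (Suc i mod length xs)} | i. i < length xs}"

definition unicyclic :: "'a set \<Rightarrow> 'a set set \<Rightarrow> bool" where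
  "unicyclic V E \<longleftrightarrow> (\<exists>!C. C \<in> {cycle_edges xs | xs. is_cycle V E xs})"

definition resolving :: "'a set \<Rightarrow> 'a set set \<Rightarrow> 'a set \<Rightarrow> bool" where
  "resolving V E S \<longleftrightarrow> S \<subseteq> V \<and>
     (\<forall>x\<in>V. \<forall>y\<in>V. x \<noteq> y \<longrightarrow> (\<exists>s\<in>S. gdist V E x s \<noteq> gdist V E y s))"

definition metric_dim :: "'a set \<Rightarrow> 'a set set \<Rightarrow> nat" where
  "metric_dim V E = (LEAST k. \<exists>S. resolving V E S \<and> card S = k)"

definition automorphism :: "'a set \<Rightarrow> 'a set set \<Rightarrow> ('a \<Rightarrow> 'a) \<Rightarrow> bool" where
  "automorphism V E f \<longleftrightarrow> bij_betw f V V \<and>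
     (\<forall>u\<in>V. \<forall>v\<in>V. adj E (f u) (f v) \<longleftrightarrow> adj E u v)"

definition distinguishing :: "'a set \<Rightarrow> 'a set set \<Rightarrow> ('a \<Rightarrow> nat) \<Rightarrow> bool" where
  "distinguishing V E c \<longleftrightarrow>
     (\<forall>f. automorphism V E f \<and> (\<forall>v\<in>V. c (f v) = c v) \<longrightarrow> (\<forall>v\<in>V. f v = v))"

definition dist_number :: "'a set \<Rightarrow> 'a set set \<Rightarrow> nat" where
  "dist_number V E = (LEAST k. \<exists>c. (\<forall>v\<in>V. c v < k) \<and> distinguishing V E c)"

definition cycle_graph_V :: "nat \<Rightarrow> nat set" where
  "cycle_graph_V m = {0..<m}"

definition cycle_graph_E :: "nat \<Rightarrow> nat set set" where
  "cycle_graph_E m = {{i, Suc i mod m} | i. i < m}"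

definition graph_iso :: "'a set \<Rightarrow> 'a set set \<Rightarrow> 'b set \<Rightarrow> 'b set set \<Rightarrow> bool" where
  "graph_iso V E V' E' \<longleftrightarrow> (\<exists>f. bij_betw f V V' \<and>
     (\<forall>u\<in>V. \<forall>v\<in>V. adj E' (f u) (f v) \<longleftrightarrow> adj E u v))"

end

theory Submission
  imports Defs
begin

text \<open>
  Colouring a resolving set injectively and everything else with one further colour is
  distinguishing, so \<open>D \<le> dim + 1\<close> always. One colour can be saved as soon as some two elements
  \<open>s \<noteq> t\<close> of a minimum resolving set \<open>S\<close> are fixed by every automorphism preserving a suitable
  set \<open>T\<close>: give \<open>T\<close> one colour, and each vertex of \<open>S - {s, t}\<close> its own.

  In a connected unicyclic graph every vertex has a gate on the cycle, through which it reaches all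
  cycle vertices. If all of \<open>S\<close> had the same gate, the two cycle neighbours of that gate would not
  be resolved; so choose \<open>s\<close>, \<open>t\<close> with different gates. If their distances to the cycle differ,
  \<open>T = {s, t}\<close> works. If these distances are equal and positive, then \<open>d(s, t) \<ge> 3\<close>, and a shortest
  path from \<open>s\<close> to \<open>t\<close> without its second vertex works. If both lie on the cycle, it suffices that
  \<open>T\<close> pins down the cycle: two adjacent cycle vertices and a neighbour of one of them off the cycle
  do, and in a cycle \<open>c\<^sub>0, c\<^sub>1, \<dots>\<close> of length at least 6 the set \<open>{c\<^sub>0, c\<^sub>2, c\<^sub>3}\<close> does. This leaves
  only cycles of length 3, 4 and 5, where every 2-colouring is invariant under a reflection.
\<close>

section \<open>Walks and distances\<close>

lemma adj_commute: "adj E x y \<longleftrightarrow> adj E y x"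
  by (simp add: adj_def insert_commute)

text \<open>Used in place of connectedness so that the lemmas on shortest paths still apply after an
  edge has been deleted, as in \<open>bridge_cut\<close>.\<close>

definition reach :: "'a set \<Rightarrow> 'a set set \<Rightarrow> 'a \<Rightarrow> 'a \<Rightarrow> bool" where
  "reach V E x y \<longleftrightarrow> (\<exists>xs. walk V E xs \<and> hd xs = x \<and> last xs = y)"

lemma walk_append:
  assumes "walk V E xs" "walk V E ys" "last xs = hd ys"
  shows "walk V E (xs @ tl ys)"
proof -
  obtain zs z where xs: "xs = zs @ [z]"
    using assms(1) by (metis walk_def append_butlast_last_id)
  have ys: "ys = z # tl ys"
    using assms xs by (metis walk_def last_snoc list.collapse)
  have eq: "xs @ tl ys = zs @ ys"
    using xs ys by simp
  have "adj E ((zs @ ys) ! i) ((zs @ ys) ! Suc i)" if "Suc i < length (zs @ ys)" for i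
  proof (cases "Suc i < length xs")
    case True
    then show ?thesis
      using assms(1) xs eq unfolding walk_def by (metis Suc_lessD nth_append_left)
  next
    case False
    then have "length zs \<le> i"
      using xs by simp
    then show ?thesis
      using assms(2) that unfolding walk_def
      by (auto simp: nth_append Suc_diff_le)
  qed
  then show ?thesis
    using assms(1,2) eq xs unfolding walk_def by auto
qed

lemma walk_take: "walk V E xs \<Longrightarrow> walk V E (take (Suc i) xs)"
  unfolding walk_def using set_take_subset[of "Suc i" xs] by auto

lemma walk_drop: "walk V E xs \<Longrightarrow> i < length xs \<Longrightarrow> walk V E (drop i xs)"
  unfolding walk_def using set_drop_subset[of i xs] by (auto simp: add.commute[of i])

lemma walk_rev:
  assumes "walk V E xs"
  shows "walk V E (rev xs)"
proof -
  have "adj E (rev xs ! i) (rev xs ! Suc i)" if "Suc i < length xs" for i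
  proof -
    have "Suc (length xs - Suc (Suc i)) = length xs - Suc i"
      using that by simp
    moreover have "Suc (length xs - Suc (Suc i)) < length xs"
      using that by simp
    ultimately have "adj E (xs ! (length xs - Suc (Suc i))) (xs ! (length xs - Suc i))"
      using assms unfolding walk_def by metis
    then show ?thesis
      using that adj_commute by (metis rev_nth Suc_lessD)
  qed
  then show ?thesis
    using assms by (simp add: walk_def)
qed

lemma walk_path:
  assumes "\<And>i. i \<le> n \<Longrightarrow> p i \<in> V" "\<And>i. i < n \<Longrightarrow> adj E (p i) (p (Suc i))"
  shows "walk V E (map p [0..<Suc n])"
  using assms unfolding walk_def by (auto simp del: upt_Suc simp: nth_map_upt)

lemma gdist_le:
  assumes "walk V E xs"
  shows "gdist V E (hd xs) (last xs) \<le> length xs - 1"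
proof -
  have "length xs = Suc (length xs - 1)"
    using assms unfolding walk_def by (cases xs) auto
  then show ?thesis
    unfolding gdist_def using assms by (intro Least_le) blast
qed

lemma shortest_walk:
  assumes "reach V E x y"
  shows "\<exists>xs. walk V E xs \<and> hd xs = x \<and> last xs = y \<and> length xs = Suc (gdist V E x y)"
proof -
  obtain xs where "walk V E xs" "hd xs = x" "last xs = y"
    using assms unfolding reach_def by blast
  moreover from this have "length xs = Suc (length xs - 1)"
    unfolding walk_def by (cases xs) auto
  ultimately have "\<exists>n xs. walk V E xs \<and> hd xs = x \<and> last xs = y \<and> length xs = Suc n"
    by blast
  from LeastI_ex[OF this] show ?thesis
    unfolding gdist_def .
qed

lemma reach_trans:
  assumes "reach V E x y" "reach V E y z"
  shows "reach V E x z" and "gdist V E x z \<le> gdist V E x y + gdist V E y z"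
proof -
  obtain xs ys where
    xs: "walk V E xs" "hd xs = x" "last xs = y" "length xs = Suc (gdist V E x y)" and
    ys: "walk V E ys" "hd ys = y" "last ys = z" "length ys = Suc (gdist V E y z)"
    using shortest_walk assms by meson
  have w: "walk V E (xs @ tl ys)"
    using walk_append xs ys by metis
  have "hd (xs @ tl ys) = x" "last (xs @ tl ys) = z"
    using xs ys by (auto simp: walk_def neq_Nil_conv last_append)
  moreover have "length (xs @ tl ys) - 1 = gdist V E x y + gdist V E y z"
    using xs ys by simp
  ultimately show "reach V E x z" "gdist V E x z \<le> gdist V E x y + gdist V E y z"
    using w gdist_le[OF w] unfolding reach_def by metis+
qed

lemma reach_edge:
  assumes "x \<in> V" "y \<in> V" "adj E x y"
  shows "reach V E x y" and "gdist V E x y \<le> 1"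
proof -
  have w: "walk V E [x, y]"
    using assms by (simp add: walk_def)
  show "reach V E x y"
    unfolding reach_def using w by force
  show "gdist V E x y \<le> 1"
    using gdist_le[OF w] by simp
qed

text \<open>Cutting a shortest walk at position \<open>i\<close> bounds both partial distances from
  above; by the triangle inequality neither bound can be strict.\<close>

lemma shortest_path:
  assumes "reach V E x y"
  obtains p where "p 0 = x" "p (gdist V E x y) = y"
    "\<And>i. i \<le> gdist V E x y \<Longrightarrow> p i \<in> V"
    "\<And>i. i < gdist V E x y \<Longrightarrow> adj E (p i) (p (Suc i))"
    "\<And>i. i \<le> gdist V E x y \<Longrightarrow> gdist V E x (p i) = i"
    "\<And>i. i \<le> gdist V E x y \<Longrightarrow> gdist V E (p i) y = gdist V E x y - i"
proof -
  let ?d = "gdist V E x y"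
  obtain xs where xs: "walk V E xs" "hd xs = x" "last xs = y" "length xs = Suc ?d"
    using shortest_walk[OF assms] by blast
  have ne: "xs \<noteq> []"
    using xs(4) by auto
  have split: "gdist V E x (xs ! i) = i \<and> gdist V E (xs ! i) y = ?d - i" if i: "i \<le> ?d" for i
  proof -
    let ?t = "take (Suc i) xs" and ?u = "drop i xs"
    have t: "walk V E ?t" "hd ?t = x" "last ?t = xs ! i" "length ?t = Suc i"
      using walk_take[OF xs(1)] xs i ne by (auto simp: last_conv_nth hd_conv_nth)
    have u: "walk V E ?u" "hd ?u = xs ! i" "last ?u = y" "length ?u = Suc (?d - i)"
      using walk_drop[OF xs(1), of i] xs i by (auto simp: hd_drop_conv_nth)
    have "gdist V E x (xs ! i) \<le> i" "gdist V E (xs ! i) y \<le> ?d - i"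
      using gdist_le[OF t(1)] gdist_le[OF u(1)] t u by simp_all
    moreover have "?d \<le> gdist V E x (xs ! i) + gdist V E (xs ! i) y"
      using t u by (intro reach_trans(2)) (auto simp: reach_def)
    ultimately show ?thesis
      using i by linarith
  qed
  show thesis
  proof (rule that[of "\<lambda>i. xs ! i"])
    show "xs ! 0 = x" "xs ! ?d = y"
      using xs ne by (auto simp: hd_conv_nth last_conv_nth)
    show "xs ! i \<in> V" if "i \<le> ?d" for i
      using xs(1,4) that nth_mem[of i xs] unfolding walk_def by auto
    show "adj E (xs ! i) (xs ! Suc i)" if "i < ?d" for i
      using xs(1,4) that unfolding walk_def by auto
  qed (use split in auto)
qed

section \<open>Distance as a metric on a connected graph\<close>

locale connected_simple_graph =
  fixes V :: "'a set" and E :: "'a set set"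
  assumes simple: "simple_graph V E" and conn: "connected_graph V E"
begin

abbreviation d :: "'a \<Rightarrow> 'a \<Rightarrow> nat" where "d \<equiv> gdist V E"

lemma finite_V: "finite V"
  using simple by (simp add: simple_graph_def)

lemma adjD: "adj E x y \<Longrightarrow> x \<in> V \<and> y \<in> V \<and> x \<noteq> y"
  using simple unfolding simple_graph_def adj_def by (metis doubleton_eq_iff)

lemma reach: "x \<in> V \<Longrightarrow> y \<in> V \<Longrightarrow> reach V E x y"
  using conn unfolding connected_graph_def reach_def by blast

lemma d_refl [simp]: "x \<in> V \<Longrightarrow> d x x = 0"
  using gdist_le[of V E "[x]"] by (simp add: walk_def)

lemma d_eq_0_iff: "x \<in> V \<Longrightarrow> y \<in> V \<Longrightarrow> d x y = 0 \<longleftrightarrow> x = y"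
  using shortest_path[OF reach, of x y] d_refl by metis

lemma d_commute_le: "x \<in> V \<Longrightarrow> y \<in> V \<Longrightarrow> d y x \<le> d x y"
  using shortest_walk[OF reach, of x y] gdist_le[OF walk_rev]
  by (metis diff_Suc_1 hd_rev last_rev length_rev)

lemma d_commute: "x \<in> V \<Longrightarrow> y \<in> V \<Longrightarrow> d x y = d y x"
  by (simp add: d_commute_le order_antisym)

lemma d_eq_1_iff:
  assumes "x \<in> V" "y \<in> V"
  shows "d x y = 1 \<longleftrightarrow> adj E x y"
proof
  assume "d x y = 1"
  then show "adj E x y"
    using shortest_path[OF reach[OF assms]] by (metis One_nat_def zero_less_one)
next
  assume "adj E x y"
  then show "d x y = 1"
    using reach_edge(2)[of x V y E] assms adjD[of x y] d_eq_0_iff[of x y] by linarith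
qed

section \<open>Automorphisms and colourings\<close>

lemma automorphism_in: "automorphism V E f \<Longrightarrow> x \<in> V \<Longrightarrow> f x \<in> V"
  unfolding automorphism_def bij_betw_def by blast

lemma automorphism_inj: "automorphism V E f \<Longrightarrow> inj_on f V"
  unfolding automorphism_def bij_betw_def by blast

lemma automorphism_adj:
  "automorphism V E f \<Longrightarrow> x \<in> V \<Longrightarrow> y \<in> V \<Longrightarrow> adj E (f x) (f y) \<longleftrightarrow> adj E x y"
  unfolding automorphism_def by blast

lemma automorphism_walk:
  assumes "automorphism V E f" "walk V E xs"
  shows "walk V E (map f xs)"
proof -
  have "xs ! i \<in> V" if "i < length xs" for i
    using assms(2) that nth_mem unfolding walk_def by blast
  then show ?thesis
    using assms automorphism_in automorphism_adj unfolding walk_def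
    by (auto simp: subset_iff)
qed

lemma automorphism_inv:
  assumes "automorphism V E f"
  shows "automorphism V E (inv_into V f)"
proof -
  let ?g = "inv_into V f"
  have bij: "bij_betw f V V"
    using assms by (simp add: automorphism_def)
  then have g: "?g x \<in> V" "f (?g x) = x" if "x \<in> V" for x
    using that by (simp_all add: bij_betw_def inv_into_into f_inv_into_f)
  have "adj E (?g u) (?g v) \<longleftrightarrow> adj E u v" if "u \<in> V" "v \<in> V" for u v
    using automorphism_adj[OF assms, of "?g u" "?g v"] g that by simp
  then show ?thesis
    using bij by (simp add: automorphism_def bij_betw_inv_into)
qed

lemma automorphism_d_le:
  assumes "automorphism V E f" "x \<in> V" "y \<in> V"
  shows "d (f x) (f y) \<le> d x y"
proof -
  obtain xs where xs: "walk V E xs" "hd xs = x" "last xs = y" "length xs = Suc (d x y)"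
    using shortest_walk reach assms by meson
  then have "xs \<noteq> []"
    by auto
  then show ?thesis
    using gdist_le[OF automorphism_walk[OF assms(1) xs(1)]] xs
    by (simp add: hd_map last_map)
qed

lemma automorphism_d:
  assumes "automorphism V E f" "x \<in> V" "y \<in> V"
  shows "d (f x) (f y) = d x y"
proof (rule order_antisym)
  show "d (f x) (f y) \<le> d x y"
    by (rule automorphism_d_le[OF assms])
  have "inv_into V f (f z) = z" if "z \<in> V" for z
    using assms that automorphism_inj inv_into_f_f by metis
  then show "d x y \<le> d (f x) (f y)"
    using automorphism_d_le[OF automorphism_inv[OF assms(1)], of "f x" "f y"] assms automorphism_in
    by metis
qed

text \<open>Automorphisms preserve distances, so \<open>x\<close> and \<open>f x\<close> are equally
  far from every fixed \<open>s\<close>; a resolving set separates distinct vertices.\<close>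

lemma resolving_determines:
  assumes "resolving V E S" "automorphism V E f" "\<And>s. s \<in> S \<Longrightarrow> f s = s" "x \<in> V"
  shows "f x = x"
proof (rule ccontr)
  assume "f x \<noteq> x"
  then obtain s where s: "s \<in> S" "d (f x) s \<noteq> d x s"
    using assms automorphism_in unfolding resolving_def by meson
  moreover have "s \<in> V"
    using s assms(1) unfolding resolving_def by blast
  ultimately show False
    using automorphism_d[OF assms(2,4), of s] assms(3) by metis
qed

section \<open>Bounding the distinguishing number by colouring a resolving set\<close>

lemma metric_basis_exists:
  obtains S where "resolving V E S" "card S = metric_dim V E"
proof -
  have "resolving V E V"
    unfolding resolving_def using d_eq_0_iff by (metis order_refl)
  then have "\<exists>k S. resolving V E S \<and> card S = k"
    by blast
  from LeastI_ex[OF this] show thesis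
    using that unfolding metric_dim_def by blast
qed

text \<open>Give the vertices of \<open>S\<close> pairwise different colours, \<open>T - S\<close>
  one colour and the remaining vertices another. A colour-preserving automorphism then fixes
  \<open>S\<close> pointwise and preserves \<open>T\<close>, so \<open>det\<close> applies.\<close>

lemma dist_number_le:
  assumes "S \<subseteq> V" "T \<subseteq> V"
    and det: "\<And>f x. \<lbrakk>automorphism V E f; \<And>s. s \<in> S \<Longrightarrow> f s = s; f ` T = T; x \<in> V\<rbrakk> \<Longrightarrow> f x = x"
  shows "dist_number V E \<le> card S + 2"
proof -
  have finS: "finite S"
    using assms(1) finite_V finite_subset by blast
  then obtain h where h: "bij_betw h S {0..<card S}"
    using ex_bij_betw_finite_nat by blast
  \<comment> \<open>Colours 0 and 1 are reserved for vertices outside \<open>S\<close>. Where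
    \<open>S\<close> and \<open>T\<close> overlap, \<open>S\<close> takes precedence.\<close>
  define c where "c v = (if v \<in> S then h v + 2 else if v \<in> T then 1 else 0)" for v
  have "h v < card S" if "v \<in> S" for v
    using h that bij_betwE by fastforce
  then have "\<forall>v\<in>V. c v < card S + 2"
    by (simp add: c_def)
  moreover have "distinguishing V E c"
    unfolding distinguishing_def
  proof (intro allI impI ballI)
    fix f x
    assume "automorphism V E f \<and> (\<forall>v\<in>V. c (f v) = c v)" and x: "x \<in> V"
    then have f: "automorphism V E f" and col: "\<And>v. v \<in> V \<Longrightarrow> c (f v) = c v"
      by auto
    have fixS: "f s = s" if "s \<in> S" for s
    proof -
      have "c (f s) = h s + 2"
        using col[of s] that subsetD[OF assms(1) that] by (simp add: c_def)
      then have "f s \<in> S" "h (f s) = h s"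
        by (auto simp: c_def split: if_splits)
      then show ?thesis
        using h that unfolding bij_betw_def inj_on_def by blast
    qed
    have "f v \<in> T" if "v \<in> T" for v
    proof (cases "v \<in> S")
      case False
      then have "c (f v) = 1"
        using col[of v] that subsetD[OF assms(2) that] by (simp add: c_def)
      then show ?thesis
        by (auto simp: c_def split: if_splits)
    qed (use fixS that in auto)
    moreover have "inj_on f T" "finite T"
      using automorphism_inj[OF f] assms(2) finite_V inj_on_subset finite_subset by blast+
    ultimately have "f ` T = T"
      by (intro endo_inj_surj) auto
    then show "f x = x"
      using det f fixS x by blast
  qed
  ultimately show ?thesis
    unfolding dist_number_def by (intro Least_le) blast
qed

text \<open>One vertex \<open>s\<close> of a metric basis needs no private colour: with
  \<open>T = {s}\<close> it is fixed anyway. Two vertices in \<open>V\<close> force the basis to be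
  nonempty, so the count is \<open>(dim - 1) + 2\<close>.\<close>

lemma dist_number_le_metric_dim_Suc:
  assumes "card V \<ge> 2"
  shows "dist_number V E \<le> metric_dim V E + 1"
proof -
  obtain S where S: "resolving V E S" "card S = metric_dim V E"
    by (rule metric_basis_exists)
  have SV: "S \<subseteq> V" "finite S"
    using S(1) finite_V finite_subset unfolding resolving_def by auto
  obtain x y where "x \<in> V" "y \<in> V" "x \<noteq> y"
    using assms card_le_Suc0_iff_eq[OF finite_V] by fastforce
  then obtain s where s: "s \<in> S"
    using S(1) unfolding resolving_def by blast
  have "dist_number V E \<le> card (S - {s}) + 2"
  proof (rule dist_number_le[of _ "{s}"])
    fix f x
    assume f: "automorphism V E f" "\<And>t. t \<in> S - {s} \<Longrightarrow> f t = t" "f ` {s} = {s}" "x \<in> V"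
    have "f t = t" if "t \<in> S" for t
      using f that by (cases "t = s") auto
    then show "f x = x"
      using resolving_determines[OF S(1) f(1) _ f(4)] by blast
  qed (use SV s in auto)
  moreover have "card S > 0"
    using SV s card_gt_0_iff by blast
  ultimately show ?thesis
    using S(2) s SV by simp
qed

text \<open>The private colours of \<open>s\<close> and \<open>t\<close> are saved, which pays for
  the two additional colours in \<open>dist_number_le\<close>.\<close>

lemma dist_number_le_card_resolving:
  assumes S: "resolving V E S" and st: "s \<in> S" "t \<in> S" "s \<noteq> t" and T: "T \<subseteq> V"
    and fixes_st: "\<And>f. \<lbrakk>automorphism V E f; f ` T = T\<rbrakk> \<Longrightarrow> f s = s \<and> f t = t"
  shows "dist_number V E \<le> card S"
proof -
  have SV: "S \<subseteq> V" "finite S"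
    using S finite_V finite_subset unfolding resolving_def by auto
  have "dist_number V E \<le> card (S - {s, t}) + 2"
  proof (rule dist_number_le[of _ T])
    fix f x
    assume f: "automorphism V E f" "\<And>r. r \<in> S - {s, t} \<Longrightarrow> f r = r" "f ` T = T" "x \<in> V"
    have "f r = r" if "r \<in> S" for r
      using f(2)[of r] fixes_st[OF f(1,3)] that by blast
    then show "f x = x"
      using resolving_determines[OF S f(1) _ f(4)] by blast
  qed (use SV T in auto)
  moreover have "card (S - {s, t}) = card S - 2" "card S \<ge> 2"
    using st SV card_mono[of S "{s, t}"] by (auto simp: card_Diff_subset)
  ultimately show ?thesis
    by simp
qed

text \<open>On a shortest path \<open>p\<close> of length at least 3, the vertex \<open>p 0\<close> is the only one without a
  neighbour in \<open>T = {p 0, p 2, p 3, \<dots>}\<close>; the other vertices of \<open>T\<close> have pairwise different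
  distances from it.\<close>

lemma far_pair_fixing_set:
  assumes "s \<in> V" "t \<in> V" "d s t \<ge> 3"
  obtains T where "T \<subseteq> V" "\<And>f. \<lbrakk>automorphism V E f; f ` T = T\<rbrakk> \<Longrightarrow> f s = s \<and> f t = t"
proof -
  obtain p where p: "p 0 = s" "p (d s t) = t" "\<And>i. i \<le> d s t \<Longrightarrow> p i \<in> V"
    "\<And>i. i < d s t \<Longrightarrow> adj E (p i) (p (Suc i))" "\<And>i. i \<le> d s t \<Longrightarrow> d s (p i) = i"
    using shortest_path[OF reach[OF assms(1,2)]] by metis
  define T where "T = p ` ({..d s t} - {1})"
  have sT: "s \<in> T" and tT: "t \<in> T"
    unfolding T_def using p(1,2) assms(3) by (force intro: image_eqI)+
  have TV: "T \<subseteq> V"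
    using p(3) unfolding T_def by auto
  have s_isolated: "\<not> adj E s x" if x: "x \<in> T" for x
  proof -
    obtain i where i: "i \<le> d s t" "i \<noteq> 1" "x = p i"
      using x unfolding T_def by auto
    then show ?thesis
      using d_eq_1_iff[OF assms(1) p(3)[OF i(1)]] p(5)[OF i(1)] by simp
  qed
  have others: "\<exists>y\<in>T. adj E x y" if x: "x \<in> T" "x \<noteq> s" for x
  proof -
    obtain i where i: "i \<le> d s t" "i \<noteq> 1" "x = p i"
      using x(1) unfolding T_def by auto
    then have i2: "i \<ge> 2"
      using x(2) p(1) by (cases i) auto
    show ?thesis
    \<comment> \<open>The end \<open>t\<close> uses its predecessor, which lies in \<open>T\<close>
      because \<open>i \<ge> 3\<close> keeps \<open>i - 1\<close> away from the omitted index
      1.\<close>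
    proof (cases "i = d s t")
      case True
      then have "p (i - 1) \<in> T" "adj E (p (i - 1)) (p i)"
        using i2 assms(3) p(4)[of "i - 1"] unfolding T_def by auto
      then show ?thesis
        using i(3) adj_commute by metis
    next
      case False
      then have "p (Suc i) \<in> T" "adj E (p i) (p (Suc i))"
        using i i2 p(4)[of i] unfolding T_def by auto
      then show ?thesis
        using i(3) by blast
    qed
  qed
  show thesis
  proof (rule that[OF TV])
    fix f
    assume f: "automorphism V E f" "f ` T = T"
    have fs: "f s = s"
    proof (rule ccontr)
      assume "f s \<noteq> s"
      then obtain y where "y \<in> T" "adj E (f s) y"
        using others f(2) sT by blast
      then obtain x where "x \<in> T" "adj E (f s) (f x)"
        using f(2) by (metis imageE)
      then show False
        using s_isolated[of x] automorphism_adj[OF f(1), of s x] TV sT by auto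
    qed
    moreover have "f t = t"
    proof -
      obtain i where i: "i \<le> d s t" "f t = p i"
        using f(2) tT unfolding T_def by auto
      then have "i = d s t"
        using automorphism_d[OF f(1) assms(1,2)] fs p(5)[OF i(1)] by simp
      then show ?thesis
        using i p(2) by simp
    qed
    ultimately show "f s = s \<and> f t = t" ..
  qed
qed

end

section \<open>The unique cycle\<close>

text \<open>Uniqueness of the cycle is stated for edge sets; this recovers the vertex set from
  them.\<close>

lemma Union_cycle_edges: "\<Union> (cycle_edges xs) = set xs"
proof
  show "\<Union> (cycle_edges xs) \<subseteq> set xs"
    by (auto simp: cycle_edges_def intro!: nth_mem mod_less_divisor)
  show "set xs \<subseteq> \<Union> (cycle_edges xs)"
  proof
    fix x
    assume "x \<in> set xs"
    then obtain i where "i < length xs" "x = xs ! i"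
      by (auto simp: in_set_conv_nth)
    then show "x \<in> \<Union> (cycle_edges xs)"
      unfolding cycle_edges_def by (intro UnionI[of "{xs ! i, xs ! (Suc i mod length xs)}"]) auto
  qed
qed

locale unicyclic_graph = connected_simple_graph +
  fixes xs :: "'a list"
  assumes cycle: "is_cycle V E xs"
    and unique: "\<And>ys. is_cycle V E ys \<Longrightarrow> cycle_edges ys = cycle_edges xs"
begin

abbreviation n :: nat where "n \<equiv> length xs"

abbreviation C :: "'a set" where "C \<equiv> set xs"

text \<open>Reading indices modulo \<open>n\<close> makes \<open>Suc\<close> the step to the next
  cycle vertex, with no separate case for closing the cycle.\<close>

definition cv :: "nat \<Rightarrow> 'a" where "cv i = xs ! (i mod n)"

lemma n_ge_3: "n \<ge> 3"
  using cycle by (simp add: is_cycle_def)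

lemma C_subset_V: "C \<subseteq> V"
  using cycle by (simp add: is_cycle_def walk_def)

lemma C_in_V: "u \<in> C \<Longrightarrow> u \<in> V"
  using C_subset_V by blast

lemma n_pos: "0 < n"
  using n_ge_3 by linarith

lemma cv_in_C: "cv i \<in> C"
  using n_pos by (simp add: cv_def)

lemma cv_in_V: "cv i \<in> V"
  using cv_in_C C_in_V by blast

lemma cv_eq_iff: "cv i = cv j \<longleftrightarrow> i mod n = j mod n"
  using cycle n_pos by (simp add: cv_def is_cycle_def nth_eq_iff_index_eq)

lemma cv_surj: "u \<in> C \<Longrightarrow> \<exists>i<n. u = cv i"
  by (auto simp: cv_def in_set_conv_nth)

lemma cycle_edges_cv: "cycle_edges xs = {{cv i, cv (Suc i)} | i. i < n}"
proof -
  have "{xs ! i, xs ! (Suc i mod n)} = {cv i, cv (Suc i)}" if "i < n" for i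
    using that by (simp add: cv_def)
  then show ?thesis
    unfolding cycle_edges_def by (metis (no_types, lifting))
qed

lemma cv_edge: "{cv i, cv (Suc i)} \<in> cycle_edges xs"
proof -
  have "cv i = cv (i mod n)" "cv (Suc i) = cv (Suc (i mod n))" "i mod n < n"
    using n_pos by (simp_all add: cv_eq_iff mod_Suc_eq)
  then show ?thesis
    unfolding cycle_edges_cv mem_Collect_eq by (intro exI[of _ "i mod n"]) simp
qed

lemma cv_adj: "adj E (cv i) (cv (Suc i))"
proof (cases "Suc (i mod n) < n")
  case True
  then have "cv (Suc i) = xs ! Suc (i mod n)"
    by (metis cv_def mod_Suc_eq mod_less)
  then show ?thesis
    using cycle True by (simp add: cv_def is_cycle_def walk_def)
next
  case False
  then have "Suc (i mod n) = n"
    using mod_less_divisor[OF n_pos, of i] by linarith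
  then have "i mod n = n - 1" "Suc i mod n = 0"
    by (simp_all add: mod_Suc)
  then have "cv i = last xs" "cv (Suc i) = hd xs"
    using n_pos by (simp_all add: cv_def last_conv_nth hd_conv_nth)
  then show ?thesis
    using cycle by (simp add: is_cycle_def)
qed

text \<open>Every edge off the cycle is a bridge: otherwise it would lie on a second cycle.\<close>

lemma bridge_cut:
  assumes ab: "adj E a b" "{a, b} \<notin> cycle_edges xs"
  obtains A where "a \<in> A" "b \<notin> A" "\<And>x y. \<lbrakk>adj E x y; x \<in> A; y \<notin> A\<rbrakk> \<Longrightarrow> x = a \<and> y = b"
    "C \<subseteq> A \<or> C \<inter> A = {}"
proof -
  let ?F = "E - {{a, b}}"
  define A where "A = {x. reach V ?F a x}"
  note abV = adjD[OF ab(1)]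
  have aA: "a \<in> A"
    unfolding A_def reach_def using abV by (auto intro: exI[of _ "[a]"] simp: walk_def)
  \<comment> \<open>Otherwise a shortest path from \<open>a\<close> to \<open>b\<close> avoiding
    their edge, which has distinct vertices, is closed by that edge to a cycle other than
    \<open>xs\<close>.\<close>
  have bA: "b \<notin> A"
  proof
    assume "b \<in> A"
    then have r: "reach V ?F a b"
      by (simp add: A_def)
    let ?m = "gdist V ?F a b"
    obtain p where p: "p 0 = a" "p ?m = b" "\<And>i. i \<le> ?m \<Longrightarrow> p i \<in> V"
      "\<And>i. i < ?m \<Longrightarrow> adj ?F (p i) (p (Suc i))" "\<And>i. i \<le> ?m \<Longrightarrow> gdist V ?F a (p i) = i"
      using shortest_path[OF r] by metis
    have "?m \<noteq> 0"
      using p(1,2) abV by metis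
    moreover have "?m \<noteq> 1"
      using p(1,2) p(4)[of 0] by (auto simp: adj_def)
    ultimately have m: "?m \<ge> 2"
      by linarith
    let ?ys = "map p [0..<Suc ?m]"
    have "adj E (p i) (p (Suc i))" if "i < ?m" for i
      using p(4)[OF that] by (simp add: adj_def)
    then have "walk V E ?ys"
      using p(3) walk_path by metis
    moreover have "distinct ?ys"
      using p(5) by (auto simp: distinct_map inj_on_def simp del: upt_Suc) (metis less_Suc_eq_le)
    moreover have hl: "hd ?ys = a" "last ?ys = b"
      using p(1,2) by (simp_all add: hd_map del: upt_Suc) simp
    ultimately have "is_cycle V E ?ys"
      using m ab(1) adj_commute[of E a b] by (simp add: is_cycle_def del: upt_Suc)
    then have "cycle_edges ?ys = cycle_edges xs"
      by (rule unique)
    \<comment> \<open>Index \<open>?m\<close> is the last vertex \<open>b\<close>; its successor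
      modulo \<open>Suc ?m\<close> wraps round to \<open>a\<close>.\<close>
    moreover have "{b, a} \<in> cycle_edges ?ys"
      unfolding cycle_edges_def mem_Collect_eq
      using p(1,2) by (intro exI[of _ ?m]) (simp add: nth_map_upt del: upt_Suc)
    ultimately show False
      using ab(2) by (simp add: insert_commute)
  qed
  have cross: "x = a \<and> y = b" if xy: "adj E x y" "x \<in> A" "y \<notin> A" for x y
  proof -
    have "\<not> adj ?F x y"
      using xy reach_edge(1)[of x V y ?F] reach_trans(1)[of V ?F a x y] adjD unfolding A_def by blast
    then have "{x, y} = {a, b}"
      using xy(1) by (simp add: adj_def)
    then show ?thesis
      using xy(2,3) aA bA by (auto simp: doubleton_eq_iff)
  qed
  \<comment> \<open>Cycle edges differ from \<open>{a, b}\<close>, so none of them leaves or enters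
    \<open>A\<close>.\<close>
  have "cv (Suc i) \<in> A \<longleftrightarrow> cv i \<in> A" for i
    using cross[of "cv i" "cv (Suc i)"] cross[of "cv (Suc i)" "cv i"] cv_adj[of i]
      adj_commute[of E "cv i"] cv_edge[of i] ab(2) by (metis insert_commute)
  then have "cv i \<in> A \<longleftrightarrow> cv 0 \<in> A" for i
    by (induction i) simp_all
  then have "C \<subseteq> A \<or> C \<inter> A = {}"
    using cv_surj by blast
  then show thesis
    using that aA bA cross by blast
qed

text \<open>A chord would be a bridge with its two ends on different sides, while \<open>C\<close>
  lies on one side.\<close>

lemma no_chord:
  assumes "u \<in> C" "v \<in> C" "adj E u v"
  shows "{u, v} \<in> cycle_edges xs"
proof (rule ccontr)
  assume "{u, v} \<notin> cycle_edges xs"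
  with assms(3) show False
    by (rule bridge_cut) (use assms in blast)
qed

lemma cv_adj_iff: "adj E (cv i) (cv j) \<longleftrightarrow> cv j = cv (Suc i) \<or> cv i = cv (Suc j)"
proof
  assume "adj E (cv i) (cv j)"
  then have "{cv i, cv j} \<in> cycle_edges xs"
    using no_chord cv_in_C by blast
  then obtain k where "{cv i, cv j} = {cv k, cv (Suc k)}"
    unfolding cycle_edges_cv by blast
  moreover have "cv (Suc k) = cv (Suc l)" if "cv k = cv l" for k l
    using that unfolding cv_eq_iff by (metis mod_Suc_eq)
  ultimately show "cv j = cv (Suc i) \<or> cv i = cv (Suc j)"
    unfolding doubleton_eq_iff by metis
next
  assume "cv j = cv (Suc i) \<or> cv i = cv (Suc j)"
  then show "adj E (cv i) (cv j)"
    using cv_adj adj_commute by metis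
qed

text \<open>The edge from \<open>x\<close> to \<open>u\<close> is a bridge with all of
  \<open>C\<close> beyond it, so the edge from \<open>x\<close> to \<open>v\<close> crosses the same
  cut and must be the same edge.\<close>

lemma off_cycle_adj_unique:
  assumes "x \<notin> C" "u \<in> C" "v \<in> C" "adj E x u" "adj E x v"
  shows "u = v"
proof -
  have "{x, u} \<notin> cycle_edges xs"
    using assms(1) Union_cycle_edges[of xs] by blast
  with assms(4) show ?thesis
  proof (rule bridge_cut)
    fix A
    assume A: "x \<in> A" "u \<notin> A" "C \<subseteq> A \<or> C \<inter> A = {}"
      "\<And>y z. \<lbrakk>adj E y z; y \<in> A; z \<notin> A\<rbrakk> \<Longrightarrow> y = x \<and> z = u"
    then have "v \<notin> A"
      using assms by blast
    then show "u = v"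
      using A(4)[OF assms(5)] A(1) by blast
  qed
qed

section \<open>Gates\<close>

text \<open>A vertex \<open>s\<close> off the cycle is separated from the cycle by the last edge of a shortest path
  to a nearest cycle vertex \<open>c\<close>.\<close>

lemma off_cycle_cut:
  assumes s: "s \<in> V" and c: "c \<in> C" "s \<noteq> c" and nearest: "\<And>u. u \<in> C \<Longrightarrow> d s c \<le> d s u"
  obtains A where "s \<in> A" "C \<inter> A = {}"
    "\<And>x y. \<lbrakk>x \<in> A; x \<in> V; y \<in> V; y \<notin> A\<rbrakk> \<Longrightarrow> d x y = d x c + d c y"
proof -
  have cV: "c \<in> V"
    using c C_in_V by blast
  obtain p where p: "p 0 = s" "p (d s c) = c" "\<And>i. i \<le> d s c \<Longrightarrow> p i \<in> V"
      "\<And>i. i < d s c \<Longrightarrow> adj E (p i) (p (Suc i))" "\<And>i. i \<le> d s c \<Longrightarrow> d s (p i) = i"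
    using shortest_path[OF reach[OF s cV]] by metis
  have pos: "d s c > 0"
    using d_eq_0_iff s cV c(2) by blast
  \<comment> \<open>The last vertex before \<open>c\<close> is nearer to \<open>s\<close> than
    \<open>c\<close> is, hence off the cycle by minimality.\<close>
  let ?a = "p (d s c - 1)"
  have a: "adj E ?a c" "?a \<in> V" "d s ?a = d s c - 1"
    using p(4)[of "d s c - 1"] p(2) p(3)[of "d s c - 1"] p(5)[of "d s c - 1"] pos by auto
  have "?a \<notin> C"
    using nearest[of ?a] a(3) pos by linarith
  then have "{?a, c} \<notin> cycle_edges xs"
    using Union_cycle_edges[of xs] by blast
  with a(1) show thesis
  proof (rule bridge_cut)
    fix A
    assume A: "?a \<in> A" "c \<notin> A" "C \<subseteq> A \<or> C \<inter> A = {}"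
      "\<And>y z. \<lbrakk>adj E y z; y \<in> A; z \<notin> A\<rbrakk> \<Longrightarrow> y = ?a \<and> z = c"
    have cross: "d x y = d x c + d c y" if xy: "x \<in> A" "x \<in> V" "y \<in> V" "y \<notin> A" for x y
    proof -
      obtain q where q: "q 0 = x" "q (d x y) = y" "\<And>i. i < d x y \<Longrightarrow> adj E (q i) (q (Suc i))"
        "\<And>i. i \<le> d x y \<Longrightarrow> d x (q i) = i" "\<And>i. i \<le> d x y \<Longrightarrow> d (q i) y = d x y - i"
        using shortest_path[OF reach[OF xy(2,3)]] by metis
      \<comment> \<open>A shortest path from \<open>x\<close> to \<open>y\<close> has to leave
        \<open>A\<close>; its only exit is the edge from \<open>?a\<close> to \<open>c\<close>, so
        it visits \<open>c\<close>.\<close>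
      have "\<exists>i<d x y. q i \<in> A \<and> q (Suc i) \<notin> A"
      proof (rule ccontr)
        assume "\<not> ?thesis"
        then have "q i \<in> A" if "i \<le> d x y" for i
          using that by (induction i) (use q(1) xy(1) in auto)
        then show False
          using q(2) xy(4) by (metis order_refl)
      qed
      then obtain i where i: "i < d x y" "q i \<in> A" "q (Suc i) \<notin> A"
        by blast
      then have "q (Suc i) = c"
        using A(4) q(3) by blast
      then show ?thesis
        using q(4,5)[of "Suc i"] i(1) by simp
    qed
    \<comment> \<open>Otherwise a shortest path from \<open>?a\<close> to \<open>s\<close> would go
      through \<open>c\<close> and be longer than \<open>d s c\<close>, although \<open>?a\<close>
      is one step closer.\<close>
    have "s \<in> A"
    proof (rule ccontr)
      assume "s \<notin> A"
      then have "d ?a s = d ?a c + d c s"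
        using cross A(1) a(2) s by blast
      then show False
        using a s cV pos d_commute[of ?a s] d_commute[of c s] by simp
    qed
    moreover have "C \<inter> A = {}"
      using A(2,3) c(1) by blast
    ultimately show thesis
      using that cross by blast
  qed
qed

text \<open>The gate of metric graph theory: the vertex where the tree containing \<open>s\<close>
  is attached to the cycle.\<close>

definition gate :: "'a \<Rightarrow> 'a \<Rightarrow> bool" where
  "gate s c \<longleftrightarrow> c \<in> C \<and> (\<forall>u\<in>C. d s u = d s c + d c u)"

lemma gate_in_C: "gate s c \<Longrightarrow> c \<in> C"
  by (simp add: gate_def)

lemma d_gate: "gate s c \<Longrightarrow> u \<in> C \<Longrightarrow> d s u = d s c + d c u"
  unfolding gate_def by blast

lemma d_gate_le: "gate s c \<Longrightarrow> u \<in> C \<Longrightarrow> d s c \<le> d s u"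
  using d_gate[of s c u] by linarith

text \<open>A nearest cycle vertex works: all of \<open>C\<close> lies outside the set
  \<open>A\<close> cut off by \<open>off_cycle_cut\<close>.\<close>

lemma gate_exists:
  assumes s: "s \<in> V"
  shows "\<exists>c. gate s c"
proof -
  obtain c where c: "c \<in> C" "\<And>u. u \<in> C \<Longrightarrow> d s c \<le> d s u"
    using cv_in_C[of 0] ex_has_least_nat[of "\<lambda>u. u \<in> C" "cv 0" "d s"] by blast
  have "gate s c"
  proof (cases "s = c")
    case True
    then show ?thesis
      using c(1) s by (simp add: gate_def)
  next
    case False
    show ?thesis
      by (rule off_cycle_cut[OF s c(1) False c(2)])
         (use c(1) s C_in_V in \<open>auto simp: gate_def\<close>)
  qed
  then show ?thesis ..
qed

text \<open>The cut at \<open>c\<close> separates \<open>s\<close> from \<open>t\<close>: if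
  \<open>t\<close> were on the side of \<open>s\<close>, it would reach \<open>c'\<close> through
  \<open>c\<close>, contradicting that \<open>c'\<close> is its gate. For \<open>s = c\<close> the
  gate equation of \<open>t\<close> suffices.\<close>

lemma d_via_gates:
  assumes s: "s \<in> V" "gate s c" and t: "t \<in> V" "gate t c'" and ne: "c \<noteq> c'"
  shows "d s t = d s c + d c c' + d c' t"
proof -
  have C: "c \<in> C" "c' \<in> C"
    using s t gate_in_C by blast+
  then have V: "c \<in> V" "c' \<in> V"
    using C_in_V by auto
  have tc: "d t c = d t c' + d c' c"
    using t C d_gate by blast
  have dct: "d c t = d c c' + d c' t"
    using tc d_commute t(1) V by (metis add.commute)
  show ?thesis
  proof (cases "s = c")
    case True
    then show ?thesis
      using dct s by simp
  next
    case False
    have "d s c \<le> d s u" if "u \<in> C" for u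
      using d_gate_le s(2) that by blast
    with s(1) C(1) False show ?thesis
    proof (rule off_cycle_cut)
      fix A
      assume A: "s \<in> A" "C \<inter> A = {}"
        "\<And>x y. \<lbrakk>x \<in> A; x \<in> V; y \<in> V; y \<notin> A\<rbrakk> \<Longrightarrow> d x y = d x c + d c y"
      have "t \<notin> A"
      proof
        assume "t \<in> A"
        then have "d t c' = d t c + d c c'"
          using A(2) A(3)[of t c'] t(1) V C by blast
        then show False
          using tc ne V d_eq_0_iff[of c c'] by simp
      qed
      then show ?thesis
        using A(3)[of s t] A(1) s(1) t(1) dct by simp
    qed
  qed
qed

lemma resolving_two_gates:
  assumes S: "resolving V E S"
  obtains s t c c' where "s \<in> S" "t \<in> S" "gate s c" "gate t c'" "c \<noteq> c'"
proof -
  have SV: "s \<in> V" if "s \<in> S" for s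
    using S that unfolding resolving_def by blast
  have res: "\<exists>s\<in>S. d x s \<noteq> d y s" if "x \<in> V" "y \<in> V" "x \<noteq> y" for x y
    using S that unfolding resolving_def by blast
  have "cv 0 \<noteq> cv 1"
    using cv_adj[of 0] adjD by fastforce
  then obtain s where s: "s \<in> S"
    using res cv_in_V by blast
  obtain c where c: "gate s c"
    using gate_exists SV s by blast
  have "c \<in> C"
    using c by (rule gate_in_C)
  then obtain i where i: "i < n" "c = cv i"
    using cv_surj by blast
  \<comment> \<open>The two cycle neighbours of \<open>c\<close>; \<open>i + n - 1\<close> is the
    predecessor of \<open>i\<close> modulo \<open>n\<close> without truncated subtraction.\<close>
  define u w where "u = cv (Suc i)" and "w = cv (i + n - 1)"
  have "cv (Suc (i + n - 1)) = c"
    using n_pos i by (simp add: cv_eq_iff)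
  then have adj: "adj E c u" "adj E c w"
    using cv_adj[of i] cv_adj[of "i + n - 1"] adj_commute i(2) unfolding u_def w_def by metis+
  have "Suc i mod n \<noteq> (i + n - 1) mod n"
  proof
    assume eq: "Suc i mod n = (i + n - 1) mod n"
    have "(i + n - 1) - Suc i = n - 2" "Suc i \<le> i + n - 1"
      using n_ge_3 by auto
    then have "n dvd n - 2"
      using eq mod_eq_dvd_iff_nat by metis
    then show False
      using n_ge_3 dvd_imp_le[of n "n - 2"] by linarith
  qed
  then have "u \<noteq> w"
    by (simp add: u_def w_def cv_eq_iff)
  then obtain t where t: "t \<in> S" "d u t \<noteq> d w t"
    using res cv_in_V unfolding u_def w_def by blast
  obtain c' where c': "gate t c'"
    using gate_exists SV t(1) by blast
  have V: "c \<in> V" "u \<in> V" "w \<in> V" "t \<in> V" and C: "u \<in> C" "w \<in> C"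
    using SV t(1) cv_in_V cv_in_C i(2) by (auto simp: u_def w_def)
  have "c \<noteq> c'"
  proof
    assume "c = c'"
    then have "d t u = d t c + d c u" "d t w = d t c + d c w"
      using c' C d_gate by blast+
    moreover have "d c u = 1" "d c w = 1"
      using adj V d_eq_1_iff by blast+
    ultimately show False
      using t(2) d_commute V by metis
  qed
  then show thesis
    using that s t(1) c c' by blast
qed

section \<open>Automorphisms and the cycle\<close>

text \<open>The image of the cycle is again a cycle, so by uniqueness it has the same edges and
  hence the same vertices.\<close>

lemma automorphism_cycle:
  assumes "automorphism V E f"
  shows "f ` C = C"
proof -
  have "inj_on f C"
    using automorphism_inj[OF assms] C_subset_V inj_on_subset by blast
  moreover have "adj E (f (last xs)) (f (hd xs))"
    using automorphism_adj[OF assms, of "last xs" "hd xs"] cycle C_in_V n_pos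
    by (simp add: is_cycle_def)
  ultimately have "is_cycle V E (map f xs)"
    using cycle automorphism_walk[OF assms] n_pos
    by (auto simp: is_cycle_def distinct_map hd_map last_map)
  then have "\<Union> (cycle_edges (map f xs)) = \<Union> (cycle_edges xs)"
    using unique by simp
  then show ?thesis
    by (simp add: Union_cycle_edges)
qed

text \<open>\<open>d s c\<close> is the distance from \<open>s\<close> to the set \<open>C\<close>,
  which \<open>f\<close> preserves.\<close>

lemma automorphism_gate_height:
  assumes f: "automorphism V E f" and s: "s \<in> V" "gate s c" and t: "gate (f s) c'"
  shows "d (f s) c' = d s c"
proof (rule order_antisym)
  have c: "c \<in> C" "c' \<in> C"
    using s t gate_in_C by blast+
  have "f c \<in> C"
    using automorphism_cycle[OF f] c by blast
  then have "d (f s) c' \<le> d (f s) (f c)"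
    using t d_gate_le by blast
  also have "\<dots> = d s c"
    using automorphism_d[OF f s(1)] c C_in_V by blast
  finally show "d (f s) c' \<le> d s c" .
  obtain u where u: "u \<in> C" "c' = f u"
    using automorphism_cycle[OF f] c by blast
  then have "d s c \<le> d s u"
    using s d_gate_le by blast
  also have "\<dots> = d (f s) c'"
    using automorphism_d[OF f s(1)] u C_in_V by metis
  finally show "d s c \<le> d (f s) c'" .
qed

text \<open>Induction along the cycle: once two consecutive vertices are fixed, the next one has
  only one possible image left.\<close>

lemma automorphism_fixes_cycle:
  assumes f: "automorphism V E f" and fx: "f (cv i) = cv i" "f (cv (Suc i)) = cv (Suc i)"
    and u: "u \<in> C"
  shows "f u = u"
proof -
  have *: "f (cv (i + j)) = cv (i + j) \<and> f (cv (Suc (i + j))) = cv (Suc (i + j))" for j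
  proof (induction j)
    case 0
    then show ?case
      using fx by simp
  next
    case (Suc j)
    let ?k = "i + j"
    obtain l where l: "f (cv (Suc (Suc ?k))) = cv l"
      using automorphism_cycle[OF f] cv_in_C cv_surj by (metis imageI)
    have "adj E (cv (Suc ?k)) (cv l)"
      using automorphism_adj[OF f cv_in_V cv_in_V] cv_adj Suc l by metis
    then have "cv l = cv (Suc (Suc ?k)) \<or> cv (Suc ?k) = cv (Suc l)"
      by (simp add: cv_adj_iff)
    \<comment> \<open>The other neighbour, \<open>cv ?k\<close>, is already its own image; by
      injectivity it would coincide with the vertex two steps on, but \<open>n \<ge> 3\<close> does
      not divide 2.\<close>
    moreover have "cv (Suc ?k) \<noteq> cv (Suc l)"
    proof
      assume "cv (Suc ?k) = cv (Suc l)"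
      then have "?k mod n = l mod n"
        by (simp add: cv_eq_iff mod_Suc split: if_splits)
      then have "f (cv (Suc (Suc ?k))) = f (cv ?k)"
        using l Suc cv_eq_iff by metis
      then have "cv (Suc (Suc ?k)) = cv ?k"
        using automorphism_inj[OF f] cv_in_V inj_onD by metis
      then have "n dvd 2"
        using mod_eq_dvd_iff_nat[of ?k "Suc (Suc ?k)" n] by (simp add: cv_eq_iff)
      then show False
        using n_ge_3 dvd_imp_le[of n 2] by linarith
    qed
    ultimately show ?case
      using l Suc by simp
  qed
  obtain k where k: "u = cv k"
    using cv_surj u by blast
  \<comment> \<open>\<open>k\<close> may be smaller than \<open>i\<close>; the index
    \<open>k + n * i\<close> names the same vertex and is reached by the induction.\<close>
  have "i \<le> n * i"
    using mult_le_mono1[of 1 n i] n_ge_3 by simp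
  then have "i + (k + n * i - i) = k + n * i"
    by linarith
  then have "cv k = cv (i + (k + n * i - i))"
    by (simp add: cv_eq_iff)
  then show ?thesis
    using * k by metis
qed

section \<open>Vertex sets whose setwise stabiliser fixes the cycle pointwise\<close>

lemma off_cycle_neighbour:
  assumes "V \<noteq> C"
  obtains x i where "x \<in> V" "x \<notin> C" "adj E x (cv i)"
proof -
  obtain y where y: "y \<in> V" "y \<notin> C"
    using assms C_subset_V by blast
  obtain p where p: "p 0 = cv 0" "p (d (cv 0) y) = y"
    "\<And>i. i < d (cv 0) y \<Longrightarrow> adj E (p i) (p (Suc i))"
    using shortest_path[OF reach[OF cv_in_V y(1)]] by metis
  have "\<exists>i<d (cv 0) y. p i \<in> C \<and> p (Suc i) \<notin> C"
  proof (rule ccontr)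
    assume "\<not> ?thesis"
    then have "p i \<in> C" if "i \<le> d (cv 0) y" for i
      using that by (induction i) (use p(1) cv_in_C in auto)
    then show False
      using p(2) y(2) by (metis order_refl)
  qed
  then obtain i where i: "i < d (cv 0) y" "p i \<in> C" "p (Suc i) \<notin> C"
    by blast
  have "adj E (p (Suc i)) (p i)"
    using p(3)[OF i(1)] adj_commute by metis
  then show thesis
    using that i cv_surj adjD by metis
qed

lemma cycle_fixing_set:
  assumes "V = C \<Longrightarrow> n \<ge> 6"
  obtains T where "T \<subseteq> V" "\<And>f u. \<lbrakk>automorphism V E f; f ` T = T; u \<in> C\<rbrakk> \<Longrightarrow> f u = u"
proof (cases "V = C")
  case False
  then obtain x i where x: "x \<in> V" "x \<notin> C" "adj E x (cv i)"
    by (rule off_cycle_neighbour)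
  let ?T = "{x, cv i, cv (Suc i)}"
  have ne: "cv i \<noteq> cv (Suc i)"
    using cv_adj adjD by blast
  have nadj: "\<not> adj E x (cv (Suc i))"
    using off_cycle_adj_unique[OF x(2) cv_in_C cv_in_C x(3)] ne by blast
  show thesis
  proof (rule that[of ?T])
    show "?T \<subseteq> V"
      using x cv_in_V by auto
    fix f u
    assume f: "automorphism V E f" "f ` ?T = ?T" and u: "u \<in> C"
    have fC: "f (cv j) \<in> C" for j
      using automorphism_cycle[OF f(1)] cv_in_C by blast
    have "f (cv j) \<noteq> x" for j
      using fC x(2) by metis
    moreover have "x \<in> f ` ?T" "f (cv i) \<in> ?T" "f (cv (Suc i)) \<in> ?T"
      using f(2) by blast+
    \<comment> \<open>Since \<open>f\<close> preserves \<open>C\<close>, it fixes \<open>x\<close>,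
      the only vertex of \<open>?T\<close> off the cycle. Adjacency to \<open>x\<close> then tells
      the other two apart.\<close>
    ultimately have fx: "f x = x" "f (cv i) \<in> {cv i, cv (Suc i)}" "f (cv (Suc i)) \<in> {cv i, cv (Suc i)}"
      by (simp_all add: image_iff) metis
    have "adj E x (f (cv i))"
      using automorphism_adj[OF f(1) x(1) cv_in_V, of i] fx(1) x(3) by simp
    then have fi: "f (cv i) = cv i"
      using fx(2) nadj by auto
    moreover have "f (cv (Suc i)) = cv (Suc i)"
      using fx(3) fi ne automorphism_inj[OF f(1)] cv_in_V by (metis inj_onD insertE singletonD)
    ultimately show "f u = u"
      using automorphism_fixes_cycle[OF f(1)] u by blast
  qed
next
  case True
  then have n: "n \<ge> 6"
    by (rule assms)
  let ?T = "{cv 0, cv 2, cv 3}"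
  have eq: "cv i = cv j \<longleftrightarrow> i = j" if "i < 6" "j < 6" for i j
    using that n by (simp add: cv_eq_iff)
  show thesis
  proof (rule that[of ?T])
    show "?T \<subseteq> V"
      using cv_in_V by auto
    fix f u
    assume f: "automorphism V E f" "f ` ?T = ?T" and u: "u \<in> C"
    have inj: "f (cv i) = f (cv j) \<longleftrightarrow> cv i = cv j" for i j
      using automorphism_inj[OF f(1)] cv_in_V by (metis inj_onD)
    have fadj: "adj E (f (cv i)) (f (cv j)) \<longleftrightarrow> adj E (cv i) (cv j)" for i j
      using automorphism_adj[OF f(1) cv_in_V cv_in_V] .
    have a: "\<not> adj E (cv 0) (cv 2)" "\<not> adj E (cv 0) (cv 3)" "adj E (cv 2) (cv 3)"
      using cv_adj_iff[of 0 2] cv_adj_iff[of 0 3] cv_adj_iff[of 2 3] by (simp_all add: eq)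
    have sym: "adj E (cv i) (cv j) \<longleftrightarrow> adj E (cv j) (cv i)" for i j
      by (rule adj_commute)
    have mem: "f (cv 0) \<in> ?T" "f (cv 2) \<in> ?T" "f (cv 3) \<in> ?T"
      using f(2) by blast+
    have d023: "f (cv 0) \<noteq> f (cv 2)" "f (cv 0) \<noteq> f (cv 3)" "f (cv 2) \<noteq> f (cv 3)"
      by (simp_all add: inj eq)
    have "adj E (f (cv 2)) (f (cv 3))"
      using fadj a(3) by blast
    \<comment> \<open>\<open>cv 0\<close> has no neighbour in \<open>?T\<close>, whereas the images
      of \<open>cv 2\<close> and \<open>cv 3\<close> are adjacent.\<close>
    then have f23: "f (cv 2) \<noteq> cv 0" "f (cv 3) \<noteq> cv 0"
      using mem(2,3) a(1,2) sym d023 by auto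
    then have f0: "f (cv 0) = cv 0"
      using mem d023 by auto
    \<comment> \<open>If \<open>cv 2\<close> went to \<open>cv 3\<close>, the image of
      \<open>cv 1\<close> would be a common neighbour of \<open>cv 0\<close> and
      \<open>cv 3\<close>; for \<open>n \<ge> 6\<close> there is none.\<close>
    have "f (cv 2) \<noteq> cv 3"
    proof
      assume f2: "f (cv 2) = cv 3"
      obtain l where l: "f (cv 1) = cv l" "l < n"
        using automorphism_cycle[OF f(1)] cv_in_C cv_surj by (metis imageI)
      have "adj E (cv 0) (cv 1)" "adj E (cv 1) (cv 2)"
        using cv_adj[of 0] cv_adj[of 1] by (simp_all add: numeral_2_eq_2)
      then have l0: "adj E (cv 0) (cv l)" and l3: "adj E (cv l) (cv 3)"
        using fadj f0 f2 l(1) by metis+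
      have "cv l = cv 2 \<or> cv l = cv 4"
        using l3 l(2) n by (auto simp: cv_adj_iff cv_eq_iff mod_Suc split: if_splits)
      moreover have "\<not> adj E (cv 0) (cv 4)"
        using cv_adj_iff[of 0 4] by (simp add: eq)
      ultimately show False
        using l0 a(1) by metis
    qed
    then have f2: "f (cv 2) = cv 2"
      using mem(2) f23 by auto
    then have "f (cv 3) = cv 3"
      using mem(3) d023 f23 by auto
    then show "f u = u"
      using automorphism_fixes_cycle[OF f(1), of 2] f2 u by (simp add: numeral_3_eq_3 numeral_2_eq_2)
  qed
qed

section \<open>The bound without the extra colour, and recognising cycle graphs\<close>

lemma dist_number_le_metric_dim:
  assumes "V = C \<Longrightarrow> n \<ge> 6"
  shows "dist_number V E \<le> metric_dim V E"
proof -
  obtain S where S: "resolving V E S" "card S = metric_dim V E"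
    by (rule metric_basis_exists)
  obtain s t c c' where st: "s \<in> S" "t \<in> S" and g: "gate s c" "gate t c'" "c \<noteq> c'"
    using resolving_two_gates[OF S(1)] .
  have V: "s \<in> V" "t \<in> V"
    using S(1) st unfolding resolving_def by auto
  have C: "c \<in> C" "c' \<in> C"
    using g gate_in_C by blast+
  then have CV: "c \<in> V" "c' \<in> V"
    using C_in_V by auto
  have dcc: "d c c' > 0"
    using g(3) CV d_eq_0_iff by blast
  have dst: "d s t = d s c + d c c' + d t c'"
    using d_via_gates[OF V(1) g(1) V(2) g(2,3)] d_commute V CV by simp
  then have ne: "s \<noteq> t"
    using dcc V by auto
  have "\<exists>T\<subseteq>V. \<forall>f. automorphism V E f \<and> f ` T = T \<longrightarrow> f s = s \<and> f t = t"
  proof (cases "d s c = d t c'")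
    case False
    have "f s = s \<and> f t = t" if f: "automorphism V E f" "f ` {s, t} = {s, t}" for f
    proof -
      \<comment> \<open>An automorphism taking \<open>s\<close> to \<open>t\<close> would make their
        distances to the cycle equal.\<close>
      have "f s \<noteq> t"
        using automorphism_gate_height[OF f(1) V(1) g(1)] g(2) False by metis
      then show ?thesis
        using f(2) ne by auto
    qed
    then show ?thesis
      using V by (intro exI[of _ "{s, t}"]) auto
  next
    case eq: True
    show ?thesis
    proof (cases "d s c = 0")
      case True
      then have "s \<in> C" "t \<in> C"
        using eq C d_eq_0_iff V CV by metis+
      then show ?thesis
        using cycle_fixing_set[OF assms] by metis
    next
      case False
      \<comment> \<open>The two equal heights and the distance between the gates each contribute at
        least 1.\<close>
      then have "d s t \<ge> 3"
        using dst dcc eq by linarith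
      then show ?thesis
        using far_pair_fixing_set[OF V] by metis
    qed
  qed
  then have "dist_number V E \<le> card S"
    using dist_number_le_card_resolving[OF S(1) st ne] by blast
  then show ?thesis
    using S(2) by simp
qed

lemma graph_iso_cycle:
  assumes "V = C"
  shows "graph_iso V E (cycle_graph_V n) (cycle_graph_E n)"
proof -
  have bij: "bij_betw cv {0..<n} V"
    unfolding assms bij_betw_def inj_on_def using cv_surj cv_in_C
    by (fastforce simp: cv_eq_iff)
  have edge: "adj (cycle_graph_E n) i j \<longleftrightarrow> adj E (cv i) (cv j)" if ij: "i < n" "j < n" for i j
  proof -
    have "adj (cycle_graph_E n) i j \<longleftrightarrow> j = Suc i mod n \<or> i = Suc j mod n"
      using ij by (auto simp: adj_def cycle_graph_E_def doubleton_eq_iff)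
    also have "\<dots> \<longleftrightarrow> adj E (cv i) (cv j)"
      using ij by (simp add: cv_adj_iff cv_eq_iff)
    finally show ?thesis .
  qed
  let ?f = "inv_into {0..<n} cv"
  have "bij_betw ?f V {0..<n}"
    using bij by (rule bij_betw_inv_into)
  moreover have "?f u < n \<and> cv (?f u) = u" if "u \<in> V" for u
    using bij that bij_betw_inv_into_right[OF bij that] inv_into_into[of u cv "{0..<n}"]
    by (auto simp: bij_betw_def)
  ultimately show ?thesis
    unfolding graph_iso_def cycle_graph_V_def using edge by metis
qed

end

section \<open>Small cycles\<close>

text \<open>The term \<open>(r + (m - i)) mod m\<close> is \<open>r - i\<close> modulo
  \<open>m\<close>, written in naturals: a reflection of the cycle.\<close>

lemma reflection_involution:
  fixes m r i :: nat
  assumes "r < m" "i < m"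
  shows "(r + (m - (r + (m - i)) mod m)) mod m = i"
proof (cases "r < i")
  case True
  then have "(r + (m - i)) mod m = r + (m - i)"
    using assms by simp
  moreover have "r + (m - (r + (m - i))) = i"
    using True assms by simp
  ultimately show ?thesis
    using assms by simp
next
  case False
  then have "r + (m - i) = (r - i) + m"
    using assms by simp
  then have "(r + (m - i)) mod m = r - i"
    using assms by (metis mod_add_self2 mod_less less_imp_diff_less)
  moreover have "r + (m - (r - i)) = i + m"
    using False assms by simp
  ultimately show ?thesis
    using assms by simp
qed

text \<open>Reflections reverse orientation; this is what makes them preserve adjacency.\<close>

lemma reflection_Suc:
  fixes m r i :: nat
  assumes "i < m"
  shows "Suc ((r + (m - Suc i mod m)) mod m) mod m = (r + (m - i)) mod m"
proof (cases "Suc i < m")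
  case True
  then have "Suc (r + (m - Suc i)) = r + (m - i)"
    by simp
  then show ?thesis
    using True by (metis mod_Suc_eq mod_less)
next
  case False
  then have m: "m = Suc i"
    using assms by simp
  have "Suc ((r + m) mod m) mod m = (r + 1) mod m"
    by (simp add: mod_Suc_eq)
  then show ?thesis
    using m by simp
qed

context connected_simple_graph
begin

context
  fixes m :: nat and g :: "nat \<Rightarrow> 'a"
  assumes bij: "bij_betw g {0..<m} V"
    and g_adj: "\<And>i j. \<lbrakk>i < m; j < m\<rbrakk> \<Longrightarrow> adj E (g i) (g j) \<longleftrightarrow> j = Suc i mod m \<or> i = Suc j mod m"
begin

text \<open>Transported to \<open>V\<close> along \<open>g\<close>, the reflection is an
  automorphism moving \<open>g i\<close>, so a distinguishing colouring cannot be invariant under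
  it.\<close>

lemma distinguishing_reflection:
  assumes c: "distinguishing V E c" and r: "r < m" and i: "i < m" "(r + (m - i)) mod m \<noteq> i"
  shows "\<exists>j<m. c (g ((r + (m - j)) mod m)) \<noteq> c (g j)"
proof (rule ccontr)
  assume "\<not> ?thesis"
  then have col: "c (g ((r + (m - j)) mod m)) = c (g j)" if "j < m" for j
    using that by blast
  define \<sigma> where "\<sigma> j = (r + (m - j)) mod m" for j
  define f where "f v = g (\<sigma> (inv_into {0..<m} g v))" for v
  have \<sigma>_less: "\<sigma> j < m" for j
    using r by (simp add: \<sigma>_def)
  have \<sigma>_\<sigma>: "\<sigma> (\<sigma> j) = j" if "j < m" for j
    using reflection_involution[OF r that] by (simp add: \<sigma>_def)
  have inj: "g j = g k \<longleftrightarrow> j = k" if "j < m" "k < m" for j k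
    using bij that by (auto simp: bij_betw_def inj_on_def)
  have f_g: "f (g j) = g (\<sigma> j)" if "j < m" for j
    using bij that by (simp add: f_def bij_betw_def)
  have ex: "\<exists>j<m. v = g j" if "v \<in> V" for v
    using bij that by (auto simp: bij_betw_def)
  have gV: "g j \<in> V" if "j < m" for j
    using bij that by (auto simp: bij_betw_def)
  have \<sigma>_Suc: "k = Suc j mod m \<Longrightarrow> \<sigma> j = Suc (\<sigma> k) mod m" if "j < m" for j k
    using reflection_Suc[OF that, of r] by (simp add: \<sigma>_def)
  then have \<sigma>_Suc_iff: "\<sigma> j = Suc (\<sigma> k) mod m \<longleftrightarrow> k = Suc j mod m" if "j < m" "k < m" for j k
    using \<sigma>_\<sigma> \<sigma>_less that by metis
  have ff: "f (f v) = v" and fV: "f v \<in> V" if v: "v \<in> V" for v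
    using ex[OF v] f_g \<sigma>_\<sigma> \<sigma>_less gV by auto
  have cf: "c (f v) = c v" if v: "v \<in> V" for v
    using ex[OF v] f_g col unfolding \<sigma>_def by metis
  have "automorphism V E f"
    unfolding automorphism_def
  proof
    show "bij_betw f V V"
      using ff fV by (intro bij_betw_byWitness[of V f f V]) auto
    show "\<forall>u\<in>V. \<forall>v\<in>V. adj E (f u) (f v) \<longleftrightarrow> adj E u v"
    proof (intro ballI)
      fix u v
      assume "u \<in> V" "v \<in> V"
      then obtain j k where "j < m" "u = g j" "k < m" "v = g k"
        using ex by meson
      then show "adj E (f u) (f v) \<longleftrightarrow> adj E u v"
        using f_g g_adj \<sigma>_less \<sigma>_Suc_iff by auto
    qed
  qed
  then have "f (g i) = g i"
    using c cf gV[OF i(1)] unfolding distinguishing_def by blast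
  then show False
    using f_g inj i \<sigma>_less by (simp add: \<sigma>_def)
qed

text \<open>Three bounds meet: no 2-colouring is distinguishing, two adjacent vertices resolve the
  cycle, and \<open>D \<le> dim + 1\<close>.\<close>

lemma small_cycle_dist_number:
  assumes m: "m = 3 \<or> m = 4 \<or> m = 5"
  shows "dist_number V E = metric_dim V E + 1"
proof -
  have card: "card V = m"
    using bij_betw_same_card[OF bij] by simp
  have gV: "g j \<in> V" if "j < m" for j
    using bij that by (auto simp: bij_betw_def)
  have inj: "g j = g k \<longleftrightarrow> j = k" if "j < m" "k < m" for j k
    using bij that by (auto simp: bij_betw_def inj_on_def)
  \<comment> \<open>An injective colouring is distinguishing, so the \<open>LEAST\<close> in
    \<open>dist_number\<close> is attained.\<close>
  have "\<exists>k c. (\<forall>v\<in>V. c v < k) \<and> distinguishing V E c"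
  proof -
    obtain c :: "'a \<Rightarrow> nat" where "bij_betw c V {0..<card V}"
      using ex_bij_betw_finite_nat[OF finite_V] by blast
    moreover from this have "distinguishing V E c"
      unfolding distinguishing_def
      by (metis automorphism_in bij_betw_imp_inj_on inj_onD)
    ultimately show ?thesis
      using bij_betwE by fastforce
  qed
  from LeastI_ex[OF this] obtain c where
    c: "\<And>v. v \<in> V \<Longrightarrow> c v < dist_number V E" "distinguishing V E c"
    unfolding dist_number_def by blast
  have "dist_number V E \<ge> 3"
  proof (rule ccontr)
    assume "\<not> ?thesis"
    \<comment> \<open>With fewer than three colours only 0 and 1 occur, so a Boolean records the
      colour.\<close>
    define b where "b i = (c (g i) = 0)" for i
    have b: "c (g i) = c (g j) \<longleftrightarrow> b i = b j" if "i < m" "j < m" for i j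
    proof -
      have "c (g i) < 2" "c (g j) < 2"
        using \<open>\<not> dist_number V E \<ge> 3\<close> c(1)[OF gV] that by fastforce+
      then show ?thesis
        by (auto simp: b_def)
    qed
    have R: "\<exists>j<m. b ((r + (m - j)) mod m) \<noteq> b j" if r: "r < m" for r
    proof -
      \<comment> \<open>No reflection is the identity: fixing index 0 forces \<open>r = 0\<close>,
        and fixing 1 as well forces \<open>m\<close> to divide 2.\<close>
      have "\<exists>i<m. (r + (m - i)) mod m \<noteq> i"
      proof (rule ccontr)
        assume "\<not> ?thesis"
        then have "(r + (m - i)) mod m = i" if "i < m" for i
          using that by blast
        from this[of 0] this[of 1] show False
          using m r by auto
      qed
      then obtain j where "j < m" "c (g ((r + (m - j)) mod m)) \<noteq> c (g j)"
        using distinguishing_reflection[OF c(2) r] by blast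
      then show ?thesis
        using b[of "(r + (m - j)) mod m" j] r by auto
    qed
    have ex3: "(\<exists>j<3. P j) \<longleftrightarrow> P 0 \<or> P 1 \<or> P 2"
      and ex4: "(\<exists>j<4. P j) \<longleftrightarrow> P 0 \<or> P 1 \<or> P 2 \<or> P 3"
      and ex5: "(\<exists>j<5. P j) \<longleftrightarrow> P 0 \<or> P 1 \<or> P 2 \<or> P 3 \<or> P 4" for P :: "nat \<Rightarrow> bool"
      by (auto simp: numeral_eq_Suc Ex_less_Suc)
    \<comment> \<open>A finite propositional check: no Boolean pattern on 3, 4 or 5 positions is
      asymmetric under all \<open>m\<close> reflections.\<close>
    from m show False
    proof (elim disjE)
      assume "m = 3"
      with R[of 0] R[of 1] R[of 2] show False
        by (simp add: ex3 flip: numeral_2_eq_2) blast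
    next
      assume "m = 4"
      with R[of 0] R[of 1] R[of 2] R[of 3] show False
        by (simp add: ex4 flip: numeral_2_eq_2) blast
    next
      assume "m = 5"
      with R[of 0] R[of 1] R[of 2] R[of 3] R[of 4] show False
        by (simp add: ex5 flip: numeral_2_eq_2) blast
    qed
  qed
  moreover have "resolving V E {g 0, g 1}"
    unfolding resolving_def
  proof (intro conjI ballI impI)
    show "{g 0, g 1} \<subseteq> V"
      using gV m by auto
    fix x y
    assume xy: "x \<in> V" "y \<in> V" "x \<noteq> y"
    then obtain i j where ij: "i < m" "x = g i" "j < m" "y = g j"
      using bij by (auto simp: bij_betw_def)
    \<comment> \<open>Adjacency of indices. In these cycles it is enough to tell apart distances 0,
      1 and larger from the two landmarks, which needs no path lengths.\<close>
    define N where "N l k \<longleftrightarrow> k = Suc l mod m \<or> l = Suc k mod m" for l k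
    have "i \<noteq> j"
      using ij xy(3) by blast
    moreover have "i = 0 \<or> i = 1 \<or> i = 2 \<or> i = 3 \<or> i = 4" "j = 0 \<or> j = 1 \<or> j = 2 \<or> j = 3 \<or> j = 4"
      using ij(1,3) m by linarith+
    ultimately have "(i = 0) \<noteq> (j = 0) \<or> N i 0 \<noteq> N j 0 \<or> (i = 1) \<noteq> (j = 1) \<or> N i 1 \<noteq> N j 1"
      using m ij(1,3) by (elim disjE) (simp_all add: N_def)
    then obtain k where k: "k = 0 \<or> k = 1" "(i = k) \<noteq> (j = k) \<or> N i k \<noteq> N j k"
      by blast
    have km: "k < m"
      using k(1) m by auto
    then have N: "adj E (g i) (g k) \<longleftrightarrow> N i k" "adj E (g j) (g k) \<longleftrightarrow> N j k"
      using g_adj ij(1,3) by (simp_all add: N_def)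
    have "(d x (g k) = 0) \<noteq> (d y (g k) = 0) \<or> (d x (g k) = 1) \<noteq> (d y (g k) = 1)"
      using k(2) N d_eq_0_iff[OF xy(1) gV[OF km]] d_eq_0_iff[OF xy(2) gV[OF km]]
        d_eq_1_iff[OF xy(1) gV[OF km]] d_eq_1_iff[OF xy(2) gV[OF km]]
        inj[OF ij(1) km] inj[OF ij(3) km] ij(2,4) by simp
    then have "d x (g k) \<noteq> d y (g k)"
      by auto
    then show "\<exists>s\<in>{g 0, g 1}. d x s \<noteq> d y s"
      using k(1) by blast
  qed
  then have "metric_dim V E \<le> card {g 0, g 1}"
    unfolding metric_dim_def by (intro Least_le) blast
  then have "metric_dim V E \<le> 2"
    using card_insert_le_m1[of 2 "{g 1}" "g 0"] by simp
  moreover have "dist_number V E \<le> metric_dim V E + 1"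
    using dist_number_le_metric_dim_Suc card m by auto
  ultimately show ?thesis
    by linarith
qed

end

lemma graph_iso_small_cycle_dist_number:
  assumes "graph_iso V E (cycle_graph_V m) (cycle_graph_E m)" "m = 3 \<or> m = 4 \<or> m = 5"
  shows "dist_number V E = metric_dim V E + 1"
proof -
  obtain h where h: "bij_betw h V {0..<m}"
    "\<And>u v. \<lbrakk>u \<in> V; v \<in> V\<rbrakk> \<Longrightarrow> adj (cycle_graph_E m) (h u) (h v) \<longleftrightarrow> adj E u v"
    using assms(1) unfolding graph_iso_def cycle_graph_V_def by blast
  let ?g = "inv_into V h"
  have bij: "bij_betw ?g {0..<m} V"
    using h(1) by (rule bij_betw_inv_into)
  have g: "?g i \<in> V" "h (?g i) = i" if "i < m" for i
    using bij h(1) that bij_betw_inv_into_right[OF h(1), of i] by (auto simp: bij_betw_def)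
  have "adj E (?g i) (?g j) \<longleftrightarrow> j = Suc i mod m \<or> i = Suc j mod m" if ij: "i < m" "j < m" for i j
  proof -
    have "adj E (?g i) (?g j) \<longleftrightarrow> adj (cycle_graph_E m) i j"
      using h(2)[of "?g i" "?g j"] g ij by simp
    also have "\<dots> \<longleftrightarrow> j = Suc i mod m \<or> i = Suc j mod m"
      using ij by (auto simp: adj_def cycle_graph_E_def doubleton_eq_iff)
    finally show ?thesis .
  qed
  with bij show ?thesis
    using assms(2) by (rule small_cycle_dist_number)
qed

end

theorem theorem3p3:
  fixes V :: "'a set" and E :: "'a set set"
  assumes "simple_graph V E" and "connected_graph V E" and "unicyclic V E"
  shows "dist_number V E = metric_dim V E + 1 \<longleftrightarrow>
    (graph_iso V E (cycle_graph_V 3) (cycle_graph_E 3) \<or>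
     graph_iso V E (cycle_graph_V 4) (cycle_graph_E 4) \<or>
     graph_iso V E (cycle_graph_V 5) (cycle_graph_E 5))"
proof -
  interpret connected_simple_graph V E
    using assms(1,2) by unfold_locales
  obtain Z where Z: "Z \<in> {cycle_edges xs | xs. is_cycle V E xs}"
    "\<And>Y. Y \<in> {cycle_edges xs | xs. is_cycle V E xs} \<Longrightarrow> Y = Z"
    using assms(3) unfolding unicyclic_def by (elim ex1E) iprover
  from Z(1) obtain xs where xs: "is_cycle V E xs" "Z = cycle_edges xs"
    by blast
  have uniq: "cycle_edges ys = cycle_edges xs" if "is_cycle V E ys" for ys
    using Z(2)[of "cycle_edges ys"] that xs(2) by blast
  interpret unicyclic_graph V E xs
    using xs(1) uniq by unfold_locales
  show ?thesis
  proof
    assume D: "dist_number V E = metric_dim V E + 1"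
    \<comment> \<open>By \<open>D\<close>, the conclusion of
      \<open>dist_number_le_metric_dim\<close> fails; hence so does its implication from
      \<open>V = C\<close> to \<open>n \<ge> 6\<close>, which gives both facts.\<close>
    have "V = C" "n < 6"
      using dist_number_le_metric_dim D by force+
    moreover from this have "n = 3 \<or> n = 4 \<or> n = 5"
      using n_ge_3 by linarith
    ultimately show "graph_iso V E (cycle_graph_V 3) (cycle_graph_E 3) \<or>
        graph_iso V E (cycle_graph_V 4) (cycle_graph_E 4) \<or>
        graph_iso V E (cycle_graph_V 5) (cycle_graph_E 5)"
      using graph_iso_cycle by metis
  qed (use graph_iso_small_cycle_dist_number in blast)
qed

end
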